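(* Let $\{\pi_k(t)\}_{k=0}^{\infty}$ be the monic Legendre polynomials, i.e. the monic polynomials with $\deg\pi_k=k$ that are mutually orthogonal with respect to $\langle f,g\rangle=\int_{-1}^{1}f(t)g(t)\,dt$, and define the classical Legendre polynomials $P_k$ by $d_k P_k(t)=\pi_k(t)$ with $d_k:=\pi_k(1)=\frac{2^k(k!)^2}{(2k)!}$, $k\ge 0$ (so that $P_k(1)=1$). Then for every $k\ge 1$, \[ (k+1)\,P_{k+1}(t)=(2k+1)\,t\,P_k(t)-k\,P_{k-1}(t), \] with $P_0(t)=1$ and $P_1(t)=t$.
   Context: A polynomial of degree $k$ is monic if its coefficient of $t^k$ equals $1$. *)

theory Defs
  imports "HOL-Analysis.Analysis" "HOL-Computational_Algebra.Polynomial"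
begin

definition legendre_inner :: "real poly \<Rightarrow> real poly \<Rightarrow> real" where
  "legendre_inner f g = integral {-1..1} (\<lambda>t. poly f t * poly g t)"

definition monic_legendre :: "(nat \<Rightarrow> real poly) \<Rightarrow> bool" where
  "monic_legendre \<pi> \<longleftrightarrow>
     (\<forall>k. degree (\<pi> k) = k \<and> lead_coeff (\<pi> k) = 1) \<and>
     (\<forall>j k. j \<noteq> k \<longrightarrow> legendre_inner (\<pi> j) (\<pi> k) = 0)"

end

theory Submission
  imports Defs
begin

text \<open>
  Let \<open>h\<^sub>k\<close> be the squared norm of \<open>\<pi>\<^sub>k\<close>. By orthogonality
  \<open>t \<pi>\<^sub>k = \<pi>\<^sub>k\<^sub>+\<^sub>1 + \<alpha> \<pi>\<^sub>k + \<beta> \<pi>\<^sub>k\<^sub>-\<^sub>1\<close> with \<open>\<beta> = h\<^sub>k / h\<^sub>k\<^sub>-\<^sub>1\<close>. By uniqueness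
  \<open>\<pi>\<^sub>k\<close> has the parity of \<open>k\<close>, so integrating \<open>(t \<pi>\<^sub>k\<^sup>2)'\<close> and \<open>(\<pi>\<^sub>k\<^sub>+\<^sub>1 \<pi>\<^sub>k)'\<close> over
  \<open>[-1, 1]\<close> gives \<open>(2k + 1) h\<^sub>k = 2 d\<^sub>k\<^sup>2\<close> and \<open>(k + 1) h\<^sub>k = 2 d\<^sub>k\<^sub>+\<^sub>1 d\<^sub>k\<close>. Hence
  \<open>d\<^sub>k\<^sub>+\<^sub>1 / d\<^sub>k = (k + 1) / (2k + 1)\<close>, which determines \<open>d\<^sub>k\<close> and \<open>\<beta>\<close>; evaluating the
  recurrence at \<open>t = 1\<close> then forces \<open>\<alpha> = 0\<close>.
\<close>

section \<open>The inner product on real polynomials\<close>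

lemma legendre_integrable [simp]:
  "(\<lambda>t. poly f t * poly g t) integrable_on {-1..1::real}"
  by (intro integrable_continuous_real continuous_intros)

lemma legendre_inner_commute: "legendre_inner f g = legendre_inner g f"
  by (simp add: legendre_inner_def mult.commute)

lemma legendre_inner_add_left:
  "legendre_inner (f + g) h = legendre_inner f h + legendre_inner g h"
  by (simp add: legendre_inner_def distrib_right integral_add)

lemma legendre_inner_diff_left:
  "legendre_inner (f - g) h = legendre_inner f h - legendre_inner g h"
  by (simp add: legendre_inner_def left_diff_distrib integral_diff)

lemma legendre_inner_smult_left:
  "legendre_inner (smult c f) h = c * legendre_inner f h"
  by (simp add: legendre_inner_def mult.assoc)

lemma legendre_inner_diff_right:
  "legendre_inner h (f - g) = legendre_inner h f - legendre_inner h g"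
  by (metis legendre_inner_commute legendre_inner_diff_left)

lemma legendre_inner_smult_right:
  "legendre_inner h (smult c f) = c * legendre_inner h f"
  by (metis legendre_inner_commute legendre_inner_smult_left)

text \<open>Multiplication operators are self-adjoint; taking \<open>[:0, 1:]\<close> for
  \<open>p\<close> moves a factor \<open>t\<close> across.\<close>

lemma legendre_inner_mult_shift:
  "legendre_inner f (p * g) = legendre_inner (p * f) g"
  by (simp add: legendre_inner_def mult_ac)

text \<open>A continuous nonnegative integrand with integral zero vanishes on the interval, which
  gives \<open>f\<close> infinitely many roots.\<close>

lemma legendre_inner_self_eq_0:
  assumes "legendre_inner f f = 0"
  shows "f = 0"
proof -
  have "\<forall>t\<in>{-1..1}. poly f t * poly f t = 0"
    using assms unfolding legendre_inner_def
    by (subst (asm) integral_eq_0_iff) (auto intro!: continuous_intros)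
  then have "{-1..1::real} \<subseteq> {t. poly f t = 0}" by auto
  moreover have "infinite {-1..1::real}" by simp
  ultimately show ?thesis
    using poly_roots_finite finite_subset by blast
qed

lemma legendre_inner_by_parts:
  "legendre_inner (pderiv f) g + legendre_inner f (pderiv g)
     = poly f 1 * poly g 1 - poly f (-1) * poly g (-1)"
proof -
  have "((\<lambda>t. poly (pderiv (f * g)) t) has_integral
          (poly (f * g) 1 - poly (f * g) (-1))) {-1..1}"
    using has_field_derivative_at_within[OF poly_DERIV[of "f * g"]]
    by (intro fundamental_theorem_of_calculus)
      (simp_all add: has_real_derivative_iff_has_vector_derivative)
  moreover have "poly (pderiv (f * g)) t
      = poly (pderiv f) t * poly g t + poly f t * poly (pderiv g) t" for t
    by (simp add: pderiv_mult)
  ultimately show ?thesis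
    by (simp add: legendre_inner_def integral_unique flip: integral_add)
qed

text \<open>Substitution of \<open>-t\<close> for \<open>t\<close>, which maps the interval to
  itself.\<close>

lemma legendre_inner_reflect:
  "legendre_inner (pcompose f [:0, -1:]) g = legendre_inner f (pcompose g [:0, -1:])"
  using Henstock_Kurzweil_Integration.integral_reflect_real[of 1 "-1" "\<lambda>t. poly f t * poly g (-t)"]
  by (simp add: legendre_inner_def poly_pcompose)

section \<open>Orthogonal expansion, uniqueness and parity\<close>

locale monic_legendre_sequence =
  fixes \<pi> :: "nat \<Rightarrow> real poly"
  assumes monic_legendre: "monic_legendre \<pi>"
begin

lemma degree_pi [simp]: "degree (\<pi> k) = k"
  and coeff_pi_same [simp]: "coeff (\<pi> k) k = 1"
  and inner_pi_pi: "j \<noteq> k \<Longrightarrow> legendre_inner (\<pi> j) (\<pi> k) = 0"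
  using monic_legendre unfolding monic_legendre_def by metis+

lemma coeff_pi_above [simp]: "k < i \<Longrightarrow> coeff (\<pi> k) i = 0"
  by (simp add: coeff_eq_0)

lemma pi_nonzero: "\<pi> k \<noteq> 0"
  using coeff_pi_same[of k] by force

text \<open>The first \<open>n\<close> members span the polynomials of degree below
  \<open>n\<close>: the induction strips the top term with a multiple of \<open>\<pi> n\<close>.
  Bounding coefficients instead of the degree makes the case \<open>n = 0\<close> mean
  \<open>p = 0\<close>.\<close>

lemma inner_eq_0_if_orthogonal_basis:
  assumes "\<And>j. j < n \<Longrightarrow> legendre_inner (\<pi> j) r = 0"
    and "\<And>i. n \<le> i \<Longrightarrow> coeff p i = 0"
  shows "legendre_inner p r = 0"
  using assms
proof (induction n arbitrary: p)
  case 0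
  then have "p = 0" by (simp add: poly_eq_iff)
  then show ?case by (simp add: legendre_inner_def)
next
  case (Suc n)
  define q where "q = p - smult (coeff p n) (\<pi> n)"
  have "coeff q i = 0" if "n \<le> i" for i
    using Suc.prems(2)[of i] that by (cases "i = n") (auto simp: q_def)
  then have "legendre_inner q r = 0"
    using Suc by simp
  then show ?case
    using Suc.prems(1)[of n]
    by (simp add: q_def legendre_inner_diff_left legendre_inner_smult_left)
qed

lemma eq_0_if_orthogonal_basis:
  assumes "\<And>j. j < n \<Longrightarrow> legendre_inner (\<pi> j) r = 0"
    and "\<And>i. n \<le> i \<Longrightarrow> coeff r i = 0"
  shows "r = 0"
  using inner_eq_0_if_orthogonal_basis[OF assms] by (rule legendre_inner_self_eq_0)

text \<open>Subtracting \<open>smult (coeff p k) (\<pi> k)\<close> leaves degree below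
  \<open>k\<close>, hence something orthogonal to \<open>\<pi> k\<close>. Inner products can thus be
  read off from one coefficient.\<close>

lemma inner_pi:
  assumes "\<And>i. k < i \<Longrightarrow> coeff p i = 0"
  shows "legendre_inner p (\<pi> k) = coeff p k * legendre_inner (\<pi> k) (\<pi> k)"
proof -
  have "legendre_inner (p - smult (coeff p k) (\<pi> k)) (\<pi> k) = 0"
  proof (rule inner_eq_0_if_orthogonal_basis[where n = k])
    show "coeff (p - smult (coeff p k) (\<pi> k)) i = 0" if "k \<le> i" for i
      using assms[of i] that by (cases "i = k") auto
  qed (simp add: inner_pi_pi)
  then show ?thesis
    by (simp add: legendre_inner_diff_left legendre_inner_smult_left)
qed

lemma pi_unique:
  assumes "\<And>j. j < k \<Longrightarrow> legendre_inner (\<pi> j) q = 0"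
    and "coeff q k = 1" and "\<And>i. k < i \<Longrightarrow> coeff q i = 0"
  shows "q = \<pi> k"
proof -
  have "q - \<pi> k = 0"
  proof (rule eq_0_if_orthogonal_basis[where n = k])
    show "coeff (q - \<pi> k) i = 0" if "k \<le> i" for i
      using assms that by (cases "i = k") auto
  qed (simp add: legendre_inner_diff_right assms inner_pi_pi)
  then show ?thesis by simp
qed

text \<open>Reflection preserves orthogonality to lower degrees, and the sign restores the leading
  coefficient 1, so uniqueness applies.\<close>

lemma pi_reflect: "smult ((-1) ^ k) (pcompose (\<pi> k) [:0, -1:]) = \<pi> k"
proof (rule pi_unique)
  fix j assume "j < k"
  have "legendre_inner (pcompose (\<pi> j) [:0, -1:]) (\<pi> k) = 0"
    by (subst inner_pi) (use \<open>j < k\<close> in \<open>auto simp: coeff_eq_0 degree_pcompose\<close>)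
  then show "legendre_inner (\<pi> j) (smult ((-1) ^ k) (pcompose (\<pi> k) [:0, -1:])) = 0"
    by (simp add: legendre_inner_smult_right legendre_inner_reflect)
next
  have "lead_coeff (pcompose (\<pi> k) [:0, -1:]) = (-1) ^ k"
    by (subst lead_coeff_comp) auto
  then show "coeff (smult ((-1) ^ k) (pcompose (\<pi> k) [:0, -1:])) k = 1"
    by (simp add: degree_pcompose flip: power_mult_distrib)
qed (simp add: coeff_eq_0 degree_pcompose)

lemma poly_pi_minus_one: "poly (\<pi> k) (-1) = (-1) ^ k * poly (\<pi> k) 1"
  using arg_cong[OF pi_reflect[of k], of "\<lambda>p. poly p (-1)"]
  by (simp add: poly_pcompose)

section \<open>Squared norms and values at 1\<close>

lemma norm_pi:
  "real (2 * k + 1) * legendre_inner (\<pi> k) (\<pi> k) = 2 * (poly (\<pi> k) 1)\<^sup>2"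
proof -
  define h where "h = legendre_inner (\<pi> k) (\<pi> k)"
  \<comment> \<open>\<open>pCons 0\<close> multiplies by \<open>t\<close>, so this polynomial has
    degree at most \<open>k\<close> and coefficient \<open>k\<close> there.\<close>
  have X: "legendre_inner (pCons 0 (pderiv (\<pi> k))) (\<pi> k) = real k * h"
    unfolding h_def
    by (subst inner_pi) (auto simp: coeff_pCons coeff_pderiv split: nat.split)
  have "pderiv (pCons 0 (\<pi> k)) = \<pi> k + pCons 0 (pderiv (\<pi> k))"
    by (simp add: pderiv_pCons)
  then have "legendre_inner (pderiv (pCons 0 (\<pi> k))) (\<pi> k) = h + real k * h"
    by (simp add: legendre_inner_add_left X h_def)
  moreover have "legendre_inner (pCons 0 (\<pi> k)) (pderiv (\<pi> k)) = real k * h"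
    using legendre_inner_mult_shift[of "\<pi> k" "[:0, 1:]" "pderiv (\<pi> k)"] X
    by (simp add: legendre_inner_commute)
  ultimately show ?thesis
    using legendre_inner_by_parts[of "pCons 0 (\<pi> k)" "\<pi> k"]
    by (simp add: h_def poly_pi_minus_one algebra_simps power2_eq_square flip: power_mult_distrib)
qed

text \<open>The derivative of \<open>\<pi> (k + 1)\<close> has top coefficient \<open>k + 1\<close>
  in degree \<open>k\<close>, while that of \<open>\<pi> k\<close> is orthogonal to
  \<open>\<pi> (k + 1)\<close>. The boundary terms add up because the product is odd.\<close>

lemma norm_pi_consecutive:
  "real (k + 1) * legendre_inner (\<pi> k) (\<pi> k) = 2 * poly (\<pi> (k + 1)) 1 * poly (\<pi> k) 1"
proof -
  have "legendre_inner (pderiv (\<pi> (k + 1))) (\<pi> k)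
      = real (k + 1) * legendre_inner (\<pi> k) (\<pi> k)"
    by (subst inner_pi) (auto simp: coeff_pderiv simp flip: Suc_eq_plus1)
  moreover have "legendre_inner (\<pi> (k + 1)) (pderiv (\<pi> k)) = 0"
    by (subst legendre_inner_commute, subst inner_pi) (auto simp: coeff_pderiv)
  ultimately show ?thesis
    using legendre_inner_by_parts[of "\<pi> (k + 1)" "\<pi> k"]
    by (simp add: poly_pi_minus_one flip: power_mult_distrib)
qed

lemma norm_pi_nonzero: "legendre_inner (\<pi> k) (\<pi> k) \<noteq> 0"
  using legendre_inner_self_eq_0 pi_nonzero by blast

lemma poly_pi_one_nonzero: "poly (\<pi> k) 1 \<noteq> 0"
  using norm_pi[of k] norm_pi_nonzero[of k] by auto

text \<open>Eliminating the squared norm from the two norm identities leaves a common factor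
  \<open>2 * poly (\<pi> k) 1\<close> to cancel.\<close>

lemma poly_pi_one_Suc:
  "real (2 * k + 1) * poly (\<pi> (k + 1)) 1 = real (k + 1) * poly (\<pi> k) 1"
proof -
  have "2 * poly (\<pi> k) 1 * (real (2 * k + 1) * poly (\<pi> (k + 1)) 1)
      = real (k + 1) * (real (2 * k + 1) * legendre_inner (\<pi> k) (\<pi> k))"
    using norm_pi_consecutive[of k] by (simp add: algebra_simps)
  also have "\<dots> = 2 * poly (\<pi> k) 1 * (real (k + 1) * poly (\<pi> k) 1)"
    unfolding norm_pi by (simp add: power2_eq_square)
  finally show ?thesis using poly_pi_one_nonzero[of k] by simp
qed

lemma pi_0: "\<pi> 0 = 1"
  by (rule pi_unique[symmetric]) auto

lemma poly_pi_one: "poly (\<pi> k) 1 = 2 ^ k * (fact k)\<^sup>2 / fact (2 * k)"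
proof (induction k)
  case 0
  show ?case by (simp add: pi_0)
next
  case (Suc k)
  have "poly (\<pi> (Suc k)) 1 = real (k + 1) * poly (\<pi> k) 1 / real (2 * k + 1)"
    using poly_pi_one_Suc[of k] by (simp add: field_simps)
  also have "\<dots> = real (k + 1) * (2 ^ k * (fact k)\<^sup>2) / (real (2 * k + 1) * fact (2 * k))"
    by (simp add: Suc)
  \<comment> \<open>Expanding the fraction by \<open>2 * k + 2\<close> completes the factorial in
    the denominator.\<close>
  also have "\<dots> = 2 * (real (k + 1))\<^sup>2 * (2 ^ k * (fact k)\<^sup>2)
      / (real (2 * k + 2) * (real (2 * k + 1) * fact (2 * k)))"
    by (simp add: divide_simps power2_eq_square)
  also have "\<dots> = 2 ^ Suc k * (fact (Suc k))\<^sup>2 / fact (2 * Suc k)"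
    by (simp add: power2_eq_square algebra_simps)
  finally show ?case .
qed

section \<open>The three-term recurrence and its normalisation\<close>

lemma pi_three_term:
  "\<exists>\<alpha>. pCons 0 (\<pi> (k + 1)) = \<pi> (k + 2) + smult \<alpha> (\<pi> (k + 1))
    + smult (legendre_inner (\<pi> (k + 1)) (\<pi> (k + 1)) / legendre_inner (\<pi> k) (\<pi> k)) (\<pi> k)"
proof -
  define h where "h j = legendre_inner (\<pi> j) (\<pi> j)" for j
  define \<alpha> where "\<alpha> = legendre_inner (\<pi> (k + 1)) (pCons 0 (\<pi> (k + 1))) / h (k + 1)"
  \<comment> \<open>The remainder has degree below \<open>k + 2\<close>, since the monic top terms
    cancel; it vanishes once it is orthogonal to all \<open>\<pi> j\<close> of such degree.\<close>
  define r where "r = pCons 0 (\<pi> (k + 1)) - \<pi> (k + 2) - smult \<alpha> (\<pi> (k + 1))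
    - smult (h (k + 1) / h k) (\<pi> k)"
  have h: "h j \<noteq> 0" for j by (simp add: h_def norm_pi_nonzero)
  have "r = 0"
  proof (rule eq_0_if_orthogonal_basis[where n = "k + 2"])
    fix j assume "j < k + 2"
    then consider "j = k + 1" | "j = k" | "j < k" by linarith
    then show "legendre_inner (\<pi> j) r = 0"
    proof cases
      case 1
      then show ?thesis
        using h[of "k + 1"] inner_pi_pi[of "Suc k" k] inner_pi_pi[of "Suc k" "Suc (Suc k)"]
        by (simp add: r_def \<alpha>_def legendre_inner_diff_right legendre_inner_smult_right h_def)
    next
      case 2
      \<comment> \<open>After the shift, \<open>t\<close> times \<open>\<pi> k\<close> is monic of
        degree \<open>k + 1\<close>.\<close>
      have "legendre_inner (\<pi> k) (pCons 0 (\<pi> (k + 1))) = h (k + 1)"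
        using legendre_inner_mult_shift[of "\<pi> k" "[:0, 1:]" "\<pi> (k + 1)"]
          inner_pi[of "k + 1" "pCons 0 (\<pi> k)"]
        by (simp add: h_def coeff_pCons split: nat.splits)
      with 2 show ?thesis
        using h[of k] inner_pi_pi[of k "Suc k"] inner_pi_pi[of k "Suc (Suc k)"]
        by (simp add: r_def legendre_inner_diff_right legendre_inner_smult_right flip: h_def)
    next
      case 3
      \<comment> \<open>Here the shifted factor has degree \<open>j + 1\<close>, still below
        \<open>k + 1\<close>.\<close>
      then have "legendre_inner (\<pi> j) (pCons 0 (\<pi> (k + 1))) = 0"
        using legendre_inner_mult_shift[of "\<pi> j" "[:0, 1:]" "\<pi> (k + 1)"]
          inner_pi[of "k + 1" "pCons 0 (\<pi> j)"]
        by (simp add: coeff_pCons split: nat.splits)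
      with 3 show ?thesis
        by (simp add: r_def legendre_inner_diff_right legendre_inner_smult_right inner_pi_pi)
    qed
  next
    fix i assume "k + 2 \<le> i"
    then show "coeff r i = 0"
      by (cases "i = k + 2") (auto simp: r_def coeff_pCons split: nat.split)
  qed
  then have "pCons 0 (\<pi> (k + 1))
      = \<pi> (k + 2) + smult \<alpha> (\<pi> (k + 1)) + smult (h (k + 1) / h k) (\<pi> k)"
    by (simp add: r_def algebra_simps)
  then show ?thesis unfolding h_def by blast
qed

text \<open>The index is raised by one to avoid truncated subtraction. Written in terms of
  \<open>p\<close>, every coefficient of the monic recurrence becomes a rational multiple of
  \<open>D (k + 1)\<close>, which cancels.\<close>

lemma normalised_three_term:
  fixes t :: real and k :: nat
  defines "p \<equiv> \<lambda>j. poly (\<pi> j) t / poly (\<pi> j) 1"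
  shows "real (k + 2) * p (k + 2) = real (2 * k + 3) * t * p (k + 1) - real (k + 1) * p k"
proof -
  define D where "D j = poly (\<pi> j) 1" for j
  define h where "h j = legendre_inner (\<pi> j) (\<pi> j)" for j
  have D: "D j \<noteq> 0" for j by (simp add: D_def poly_pi_one_nonzero)
  obtain \<alpha> where \<alpha>: "pCons 0 (\<pi> (k + 1))
      = \<pi> (k + 2) + smult \<alpha> (\<pi> (k + 1)) + smult (h (k + 1) / h k) (\<pi> k)"
    using pi_three_term unfolding h_def by blast
  have D2: "D (k + 2) = real (k + 2) / real (2 * k + 3) * D (k + 1)"
    using poly_pi_one_Suc[of "k + 1"] by (simp add: D_def field_simps)
  have h1: "h (k + 1) = 2 / real (2 * k + 3) * (D (k + 1))\<^sup>2"
    using norm_pi[of "k + 1"] by (simp add: D_def h_def field_simps)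
  have h2: "real (k + 1) * h k = 2 * D (k + 1) * D k"
    using norm_pi_consecutive[of k] by (simp add: D_def h_def)
  have hD: "h (k + 1) / h k * D k = real (k + 1) / real (2 * k + 3) * D (k + 1)"
  proof -
    have "h (k + 1) / h k * D k
        = (2 * D (k + 1) * D k) * D (k + 1) / (real (2 * k + 3) * h k)"
      unfolding h1 by (simp add: power2_eq_square)
    also have "\<dots> = (real (k + 1) * h k) * D (k + 1) / (real (2 * k + 3) * h k)"
      by (simp only: h2)
    also have "\<dots> = real (k + 1) / real (2 * k + 3) * D (k + 1)"
      using norm_pi_nonzero[of k, folded h_def] by simp
    finally show ?thesis .
  qed
  have rec: "s * poly (\<pi> (k + 1)) s = poly (\<pi> (k + 2)) s + \<alpha> * poly (\<pi> (k + 1)) s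
      + h (k + 1) / h k * poly (\<pi> k) s" for s
    using arg_cong[OF \<alpha>, of "\<lambda>p. poly p s"] by simp
  have "D (k + 1) = D (k + 2) + \<alpha> * D (k + 1) + h (k + 1) / h k * D k"
    using rec[of 1] by (simp add: D_def)
  also have "\<dots> = D (k + 1) * (real (k + 2) / real (2 * k + 3) + \<alpha>
      + real (k + 1) / real (2 * k + 3))"
    unfolding hD D2 by (simp only: algebra_simps)
  finally have "real (k + 2) / real (2 * k + 3) + \<alpha> + real (k + 1) / real (2 * k + 3) = 1"
    using D[of "k + 1"] by simp
  \<comment> \<open>The numerators add up to \<open>2 * k + 3\<close>, so nothing is left for
    \<alpha>.\<close>
  moreover have "real (k + 2) / real (2 * k + 3) + real (k + 1) / real (2 * k + 3) = 1"
    by (simp flip: add_divide_distrib)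
  ultimately have \<alpha>0: "\<alpha> = 0" by linarith
  have "t * (D (k + 1) * p (k + 1)) = D (k + 2) * p (k + 2) + h (k + 1) / h k * D k * p k"
    using rec[of t] \<alpha>0 D by (simp add: p_def D_def)
  also have "\<dots> = D (k + 1) * (real (k + 2) / real (2 * k + 3) * p (k + 2)
      + real (k + 1) / real (2 * k + 3) * p k)"
    unfolding hD D2 by (simp only: algebra_simps)
  finally have "D (k + 1) * (t * p (k + 1)) = D (k + 1) * (real (k + 2) / real (2 * k + 3) * p (k + 2)
      + real (k + 1) / real (2 * k + 3) * p k)"
    by (simp only: mult_ac)
  then have "t * p (k + 1) = real (k + 2) / real (2 * k + 3) * p (k + 2)
      + real (k + 1) / real (2 * k + 3) * p k"
    using D[of "k + 1"] mult_cancel_left by blast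
  also have "\<dots> = (real (k + 2) * p (k + 2) + real (k + 1) * p k) / real (2 * k + 3)"
    by (simp only: add_divide_distrib times_divide_eq_left)
  finally have "real (2 * k + 3) * (t * p (k + 1)) = real (k + 2) * p (k + 2) + real (k + 1) * p k"
    by (simp only: nonzero_eq_divide_eq of_nat_eq_0_iff mult.commute)
  then show ?thesis by (simp add: mult.assoc)
qed

text \<open>Parity at \<open>-1\<close> reads \<open>c - 1 = -(c + 1)\<close>, so the constant term
  is zero.\<close>

lemma pi_1: "\<pi> 1 = [:0, 1:]"
proof -
  define c where "c = coeff (\<pi> 1) 0"
  have "\<pi> 1 = [:c, 1:]"
    using coeff_pi_same[of 1] coeff_pi_above[of 1]
    by (intro poly_eqI) (auto simp: c_def coeff_pCons split: nat.split)
  then show ?thesis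
    using poly_pi_minus_one[of 1] by simp
qed

end

theorem theorem2p11:
  fixes \<pi> P :: "nat \<Rightarrow> real poly" and d :: "nat \<Rightarrow> real"
  assumes "monic_legendre \<pi>"
    and "\<And>k. d k = poly (\<pi> k) 1"
    and "\<And>k. smult (d k) (P k) = \<pi> k"
  shows "(\<forall>k. d k = 2 ^ k * (fact k)\<^sup>2 / fact (2 * k)) \<and>
         (\<forall>k. poly (P k) 1 = 1) \<and>
         (\<forall>k\<ge>1. \<forall>t. real (k + 1) * poly (P (k + 1)) t
            = real (2 * k + 1) * t * poly (P k) t - real k * poly (P (k - 1)) t) \<and>
         (\<forall>t. poly (P 0) t = 1) \<and>
         (\<forall>t. poly (P 1) t = t)"
proof -
  interpret monic_legendre_sequence \<pi>
    by unfold_locales (rule assms(1))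
  \<comment> \<open>As \<open>d k\<close> is nonzero, the scaling hypothesis determines
    \<open>P k\<close>.\<close>
  have P: "poly (P k) t = poly (\<pi> k) t / poly (\<pi> k) 1" for k t
    using arg_cong[OF assms(3)[of k], of "\<lambda>p. poly p t"] poly_pi_one_nonzero[of k]
    by (simp add: assms(2) field_simps)
  have "real (k + 1) * poly (P (k + 1)) t
      = real (2 * k + 1) * t * poly (P k) t - real k * poly (P (k - 1)) t"
    if "k \<ge> 1" for k t
  proof -
    obtain j where "k = j + 1" using \<open>k \<ge> 1\<close> by (metis le_add_diff_inverse2)
    then show ?thesis
      using normalised_three_term[of j t] by (simp add: P algebra_simps)
  qed
  moreover have "poly (P 0) t = 1" "poly (P 1) t = t" for t
    using pi_1 by (simp_all add: P pi_0)
  moreover have "poly (P k) 1 = 1" for k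
    using poly_pi_one_nonzero[of k] by (simp add: P)
  moreover have "d k = 2 ^ k * (fact k)\<^sup>2 / fact (2 * k)" for k
    by (simp only: assms(2) poly_pi_one)
  ultimately show ?thesis by blast
qed

end
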